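(* Let $A\in\mathbb{R}^{m\times n}$ and $b\in\mathbb{R}^m$ be such that $\mathcal{X}:=\{x\in\{0,1\}^n:Ax\le b\}$ is nonempty and $\mathrm{conv}(\mathcal{X})=\{x\in\mathbb{R}^n:Ax\le b\}$. Let $D\in\mathbb{R}^{q\times n}$ and $g\in\mathbb{R}^q$ be such that $\mathcal{U}:=\{\theta\in\mathbb{R}^n:D\theta\ge g\}$ is nonempty and bounded. Let $\eta\in\mathbb{R}$ and $\mathcal{U}_\eta:=\{\theta\in\mathcal{U}:\max_{x\in\mathcal{X}}\theta^{\top}x\le\eta\}$. If $\mathcal{U}_\eta$ is nonempty, then $\max_{x\in\mathcal{X}}\min_{\theta\in\mathcal{U}_\eta}\theta^{\top}x$ is equal to the optimal value of the mixed-integer linear program $$\begin{aligned}\underset{x\in\{0,1\}^n,\ \psi\in\mathbb{R}^q,\ \sigma\in\mathbb{R}}{\text{maximize}}\quad & g^{\top}\psi-\eta\sigma\\ \text{subject to}\quad & Ax\le b,\\ & A\,(D^{\top}\psi-x)\le b\,\sigma,\\ & \psi\ge 0,\ \sigma\ge 0.\end{aligned}$$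
   Context: $\mathrm{conv}$ denotes the convex hull and inequalities between vectors are componentwise. (For instance, the hypotheses on $A,b$ hold when $A$ is totally unimodular, $b$ is integral, the constraints $0\le x\le 1$ are included in $Ax\le b$, and $\mathcal{X}\neq\emptyset$.) *)

theory Defs
  imports "HOL-Analysis.Analysis"
begin

text \<open>Throughout, \<open>\<le>\<close> on \<open>real ^ 'k\<close> is the library's componentwise order.\<close>

definition binary_vectors :: "(real ^ 'n) set" where
  "binary_vectors = {x. \<forall>j. x $ j \<in> {0, 1}}"

definition binary_feasible :: "real ^ 'n ^ 'm \<Rightarrow> real ^ 'm \<Rightarrow> (real ^ 'n) set" where
  "binary_feasible A b = {x \<in> binary_vectors. A *v x \<le> b}"

definition uncertainty_set :: "real ^ 'n ^ 'q \<Rightarrow> real ^ 'q \<Rightarrow> (real ^ 'n) set" where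
  "uncertainty_set D g = {\<theta>. D *v \<theta> \<ge> g}"

text \<open>\<open>Max\<close> is unspecified on infinite and on empty sets. Here it is applied to the image of
  \<open>binary_feasible A b\<close>, which is always finite and is assumed nonempty wherever this
  definition is used.\<close>

definition restricted_uncertainty_set ::
    "real ^ 'n ^ 'm \<Rightarrow> real ^ 'm \<Rightarrow> real ^ 'n ^ 'q \<Rightarrow> real ^ 'q \<Rightarrow> real \<Rightarrow> (real ^ 'n) set" where
  "restricted_uncertainty_set A b D g \<eta> =
     {\<theta> \<in> uncertainty_set D g. Max ((\<lambda>x. \<theta> \<bullet> x) ` binary_feasible A b) \<le> \<eta>}"

definition milp_feasible ::
    "real ^ 'n ^ 'm \<Rightarrow> real ^ 'm \<Rightarrow> real ^ 'n ^ 'q \<Rightarrow> ((real ^ 'n) \<times> (real ^ 'q) \<times> real) set" where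
  "milp_feasible A b D =
     {(x, \<psi>, \<sigma>). x \<in> binary_vectors \<and> A *v x \<le> b \<and>
        A *v (transpose D *v \<psi> - x) \<le> \<sigma> *\<^sub>R b \<and> \<psi> \<ge> 0 \<and> \<sigma> \<ge> 0}"

definition milp_objective :: "real ^ 'q \<Rightarrow> real \<Rightarrow> (real ^ 'n) \<times> (real ^ 'q) \<times> real \<Rightarrow> real" where
  "milp_objective g \<eta> = (\<lambda>(x, \<psi>, \<sigma>). g \<bullet> \<psi> - \<eta> * \<sigma>)"

text \<open>Optimal values over possibly infinite sets are stated relationally, so that existence
  (attainment) is part of the claim and no default value of \<open>Sup\<close> or \<open>Inf\<close> can interfere.
  Such a value is unique if it exists.\<close>

definition is_max_value :: "('a \<Rightarrow> real) \<Rightarrow> 'a set \<Rightarrow> real \<Rightarrow> bool" where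
  "is_max_value f S v \<longleftrightarrow> (\<exists>x\<in>S. f x = v) \<and> (\<forall>x\<in>S. f x \<le> v)"

definition is_min_value :: "('a \<Rightarrow> real) \<Rightarrow> 'a set \<Rightarrow> real \<Rightarrow> bool" where
  "is_min_value f S v \<longleftrightarrow> (\<exists>x\<in>S. f x = v) \<and> (\<forall>x\<in>S. v \<le> f x)"

end

theory Submission
  imports Defs
begin

text \<open>For fixed \<open>x\<close> the inner minimum is a linear program over the polyhedron cut out by
  \<open>D\<theta> \<ge> g\<close> and \<open>\<theta> \<bullet> x' \<le> \<eta>\<close> for \<open>x' \<in> \<X>\<close>. Its dual has a multiplier \<open>\<psi>\<close> for the first family
  and one multiplier per \<open>x'\<close> for the second; the latter enter only through their sum \<open>\<sigma>\<close> and
  the vector \<open>D\<^sup>T\<psi> - x \<in> \<sigma> conv \<X>\<close>. The hypothesis on \<open>conv \<X>\<close> turns this membership into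
  \<open>A (D\<^sup>T\<psi> - x) \<le> \<sigma> b\<close>. Dual attainment follows from closedness of finitely generated cones;
  boundedness of \<open>\<U>\<close> rules out the recession directions that would otherwise spoil the separation.\<close>

text \<open>A finitely generated cone is closed, so a point outside it is strictly separated from
  it. Invariance under scaling then moves the threshold from \<open>c\<close> to 0.\<close>

lemma convex_cone_hull_Farkas:
  fixes S :: "'a::euclidean_space set"
  assumes "finite S" "z \<notin> convex_cone hull S"
  obtains a where "a \<bullet> z < 0" "\<And>s. s \<in> S \<Longrightarrow> a \<bullet> s \<ge> 0"
proof -
  obtain a c where az: "a \<bullet> z < c" and c: "\<forall>y \<in> convex_cone hull S. a \<bullet> y > c"
    using separating_hyperplane_closed_point[OF convex_convex_cone_hull
        closed_convex_cone_hull[OF assms(1)] assms(2)] by blast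
  have "c < 0"
    using c convex_cone_hull_contains_0[of S] by force
  have "a \<bullet> s \<ge> 0" if "s \<in> S" for s
  proof (rule ccontr)
    assume "\<not> a \<bullet> s \<ge> 0"
    then have neg: "a \<bullet> s < 0" by simp
    with \<open>c < 0\<close> have "0 \<le> c / (a \<bullet> s)"
      by (simp add: divide_nonpos_neg)
    \<comment> \<open>Both \<open>c\<close> and \<open>a \<bullet> s\<close> are negative, so this
      multiple of \<open>s\<close> stays in the cone, yet it lies exactly on the separating
      hyperplane.\<close>
    then have "(c / (a \<bullet> s)) *\<^sub>R s \<in> convex_cone hull S"
      by (intro convex_cone_hull_mul hull_inc that)
    with c have "a \<bullet> ((c / (a \<bullet> s)) *\<^sub>R s) > c" by blast
    with neg show False by simp
  qed
  then show thesis using that az \<open>c < 0\<close> by force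
qed

lemma inner_transpose_matrix_vector:
  fixes D :: "real ^ 'n ^ 'q"
  shows "\<theta> \<bullet> (transpose D *v \<psi>) = (D *v \<theta>) \<bullet> \<psi>"
  by (metis dot_lmul_matrix inner_commute vector_transpose_matrix transpose_transpose)

lemma inner_mono_vec:
  fixes u v w :: "real ^ 'k"
  assumes "u \<le> v" "0 \<le> w"
  shows "u \<bullet> w \<le> v \<bullet> w"
  using assms by (auto simp: inner_vec_def less_eq_vec_def intro!: sum_mono mult_right_mono)

lemma finite_binary_vectors: "finite (binary_vectors :: (real ^ 'n) set)"
proof -
  have "binary_vectors \<subseteq> range (\<lambda>S. (\<chi> j. if j \<in> S then 1 else 0) :: real ^ 'n)"
  proof
    fix x :: "real ^ 'n" assume "x \<in> binary_vectors"
    then have "x = (\<chi> j. if j \<in> {j. x $ j = 1} then 1 else 0)"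
      by (auto simp: binary_vectors_def vec_eq_iff)
    then show "x \<in> range (\<lambda>S. (\<chi> j. if j \<in> S then 1 else 0) :: real ^ 'n)"
      by blast
  qed
  then show ?thesis by (rule finite_subset) simp
qed

lemma finite_binary_feasible: "finite (binary_feasible A b)"
  by (rule finite_subset[OF _ finite_binary_vectors]) (auto simp: binary_feasible_def)

text \<open>Since \<X> is finite and nonempty, the bound on \<open>Max\<close> unfolds into finitely
  many linear constraints on \<theta>. This exhibits the set as a polyhedron.\<close>

lemma restricted_uncertainty_set_iff:
  assumes "binary_feasible A b \<noteq> {}"
  shows "\<theta> \<in> restricted_uncertainty_set A b D g \<eta> \<longleftrightarrow>
    g \<le> D *v \<theta> \<and> (\<forall>x\<in>binary_feasible A b. \<theta> \<bullet> x \<le> \<eta>)"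
  using assms finite_binary_feasible[of A b]
  by (auto simp: restricted_uncertainty_set_def uncertainty_set_def)

lemma closed_uncertainty_set: "closed (uncertainty_set D g)"
proof -
  have "uncertainty_set D g = (\<Inter>i. {\<theta>. D $ i \<bullet> \<theta> \<ge> g $ i})"
    by (auto simp: uncertainty_set_def less_eq_vec_def matrix_vector_mul_component)
  then show ?thesis
    by (simp add: closed_INT closed_halfspace_ge)
qed

text \<open>Guarantees that the inner minimum is attained.\<close>

lemma compact_restricted_uncertainty_set:
  assumes "binary_feasible A b \<noteq> {}" "bounded (uncertainty_set D g)"
  shows "compact (restricted_uncertainty_set A b D g \<eta>)"
proof -
  have "restricted_uncertainty_set A b D g \<eta> =
      uncertainty_set D g \<inter> (\<Inter>x\<in>binary_feasible A b. {\<theta>. x \<bullet> \<theta> \<le> \<eta>})"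
    using restricted_uncertainty_set_iff[OF assms(1)]
    by (auto simp: uncertainty_set_def inner_commute)
  moreover have "compact (uncertainty_set D g)"
    using assms(2) closed_uncertainty_set by (simp add: compact_eq_bounded_closed)
  ultimately show ?thesis
    by (simp add: compact_Int_closed closed_INT closed_halfspace_le)
qed

text \<open>For \<sigma> > 0 divide \<open>y\<close> by \<sigma>. For \<sigma> = 0 the vector
  \<open>y\<close> is a recession direction of the polyhedron, and a functional bounded above there
  cannot increase along it; \<open>z\<close> supplies a starting point for the ray.\<close>

lemma inner_le_scaled_polyhedron:
  fixes A :: "real ^ 'n ^ 'm"
  assumes "A *v z \<le> b" and le: "\<And>y. A *v y \<le> b \<Longrightarrow> \<theta> \<bullet> y \<le> \<eta>"
    and y: "A *v y \<le> \<sigma> *\<^sub>R b" and "0 \<le> \<sigma>"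
  shows "\<theta> \<bullet> y \<le> \<eta> * \<sigma>"
proof (cases "\<sigma> = 0")
  case True
  have "\<theta> \<bullet> y \<le> 0"
  proof (rule ccontr)
    assume "\<not> \<theta> \<bullet> y \<le> 0"
    then have pos: "\<theta> \<bullet> y > 0" by simp
    \<comment> \<open>Chosen so that the functional takes the value \<eta> + 1 at
      \<open>z + k *\<^sub>R y\<close>.\<close>
    define k where "k = (\<eta> - \<theta> \<bullet> z + 1) / (\<theta> \<bullet> y)"
    have "0 \<le> k"
      using pos le[OF assms(1)] by (simp add: k_def)
    have "A *v (z + k *\<^sub>R y) \<le> b"
    proof -
      have "k *\<^sub>R (A *v y) \<le> k *\<^sub>R 0"
        using y True \<open>0 \<le> k\<close> by (intro scaleR_left_mono) auto
      then show ?thesis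
        using assms(1) add_mono by (fastforce simp: matrix_vector_right_distrib matrix_vector_mult_scaleR)
    qed
    from le[OF this] pos show False
      by (simp add: inner_add_right k_def)
  qed
  with True show ?thesis by simp
next
  case False
  with assms(4) have "\<sigma> > 0" by simp
  have "A *v ((1 / \<sigma>) *\<^sub>R y) \<le> (1 / \<sigma>) *\<^sub>R \<sigma> *\<^sub>R b"
    unfolding matrix_vector_mult_scaleR using y \<open>\<sigma> > 0\<close> by (intro scaleR_left_mono) auto
  then have "\<theta> \<bullet> ((1 / \<sigma>) *\<^sub>R y) \<le> \<eta>"
    using \<open>\<sigma> > 0\<close> by (intro le) simp
  then show ?thesis
    using \<open>\<sigma> > 0\<close> by (simp add: field_simps)
qed

text \<open>Weak duality: split \<open>transpose D *v \<psi>\<close> into \<open>x\<close> and a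
  remainder in the polyhedron scaled by \<sigma>, on which \<theta> is at most \<eta> *
  \<sigma>.\<close>

lemma milp_objective_le:
  assumes ne: "binary_feasible A b \<noteq> {}"
    and hull: "convex hull (binary_feasible A b) = {x. A *v x \<le> b}"
    and \<theta>: "\<theta> \<in> restricted_uncertainty_set A b D g \<eta>"
    and feas: "(x, \<psi>, \<sigma>) \<in> milp_feasible A b D"
  shows "milp_objective g \<eta> (x, \<psi>, \<sigma>) \<le> \<theta> \<bullet> x"
proof -
  have D\<theta>: "g \<le> D *v \<theta>" and X: "\<And>x'. x' \<in> binary_feasible A b \<Longrightarrow> \<theta> \<bullet> x' \<le> \<eta>"
    using \<theta> unfolding restricted_uncertainty_set_iff[OF ne] by auto
  \<comment> \<open>A half-space containing \<X> contains its hull, which by hypothesis is the whole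
    polyhedron.\<close>
  have "convex hull (binary_feasible A b) \<subseteq> {y. \<theta> \<bullet> y \<le> \<eta>}"
    by (intro hull_minimal) (auto simp: X convex_halfspace_le)
  then have le: "\<theta> \<bullet> y \<le> \<eta>" if "A *v y \<le> b" for y
    using hull that by blast
  have Ax: "A *v x \<le> b" and y: "A *v (transpose D *v \<psi> - x) \<le> \<sigma> *\<^sub>R b"
    and nonneg: "0 \<le> \<psi>" "0 \<le> \<sigma>"
    using feas by (auto simp: milp_feasible_def)
  have "g \<bullet> \<psi> \<le> \<theta> \<bullet> (transpose D *v \<psi>)"
    unfolding inner_transpose_matrix_vector by (rule inner_mono_vec[OF D\<theta> nonneg(1)])
  also have "\<dots> \<le> \<theta> \<bullet> x + \<eta> * \<sigma>"
    using inner_le_scaled_polyhedron[OF Ax le y nonneg(2)] by (simp add: inner_diff_right)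
  finally show ?thesis
    by (simp add: milp_objective_def)
qed

text \<open>Otherwise a ray in direction \<theta> would stay inside the bounded set. This later
  excludes separating functionals that cannot be normalised.\<close>

lemma bounded_polyhedron_recession:
  fixes D :: "real ^ 'n ^ 'q"
  assumes "bounded (uncertainty_set D g)" "\<theta>\<^sub>0 \<in> uncertainty_set D g" "0 \<le> D *v \<theta>"
  shows "\<theta> = 0"
proof (rule ccontr)
  assume "\<theta> \<noteq> 0"
  have ray: "\<theta>\<^sub>0 + k *\<^sub>R \<theta> \<in> uncertainty_set D g" if "0 \<le> k" for k
  proof -
    have "0 \<le> k *\<^sub>R (D *v \<theta>)"
      using assms(3) that by (simp add: scaleR_nonneg_nonneg)
    then show ?thesis
      using assms(2) add_mono[of g "D *v \<theta>\<^sub>0" 0 "k *\<^sub>R (D *v \<theta>)"]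
      by (simp add: uncertainty_set_def matrix_vector_right_distrib matrix_vector_mult_scaleR)
  qed
  obtain B where B: "\<And>\<theta>'. \<theta>' \<in> uncertainty_set D g \<Longrightarrow> norm \<theta>' \<le> B"
    using assms(1) by (auto simp: bounded_iff)
  \<comment> \<open>Makes the norm of \<open>k *\<^sub>R \<theta>\<close> one more than the triangle
    inequality allows.\<close>
  define k where "k = (B + norm \<theta>\<^sub>0 + 1) / norm \<theta>"
  have "0 \<le> B" using B[OF assms(2)] norm_ge_zero order_trans by blast
  then have "0 \<le> k" by (simp add: k_def)
  have "norm (k *\<^sub>R \<theta>) \<le> norm (\<theta>\<^sub>0 + k *\<^sub>R \<theta>) + norm \<theta>\<^sub>0"
    using norm_triangle_ineq4[of "\<theta>\<^sub>0 + k *\<^sub>R \<theta>" \<theta>\<^sub>0] by simp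
  also have "\<dots> \<le> B + norm \<theta>\<^sub>0"
    using B[OF ray[OF \<open>0 \<le> k\<close>]] by simp
  finally show False
    using \<open>\<theta> \<noteq> 0\<close> \<open>0 \<le> B\<close> by (simp add: k_def)
qed

text \<open>Strong duality with attainment: every lower bound \<mu> on the inner minimum at
  \<open>x\<close> is certified by multipliers for the same \<open>x\<close>.\<close>

lemma milp_dual_attained:
  fixes A :: "real ^ 'n ^ 'm" and D :: "real ^ 'n ^ 'q"
  assumes ne: "binary_feasible A b \<noteq> {}"
    and bdd: "bounded (uncertainty_set D g)"
    and \<theta>\<^sub>0: "\<theta>\<^sub>0 \<in> restricted_uncertainty_set A b D g \<eta>"
    and x: "x \<in> binary_feasible A b"
    and \<mu>: "\<And>\<theta>. \<theta> \<in> restricted_uncertainty_set A b D g \<eta> \<Longrightarrow> \<mu> \<le> \<theta> \<bullet> x"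
  obtains \<psi> \<sigma> where "(x, \<psi>, \<sigma>) \<in> milp_feasible A b D" "\<mu> \<le> milp_objective g \<eta> (x, \<psi>, \<sigma>)"
proof -
  define X where "X = binary_feasible A b"
  \<comment> \<open>Constraint normals paired with their right-hand sides, all constraints oriented
    as lower bounds. The generator \<open>(0, - 1)\<close> allows a bound to be weakened.\<close>
  define S where "S = range (\<lambda>i. (D $ i, g $ i)) \<union> (\<lambda>x'. (- x', - \<eta>)) ` X \<union> {(0, - 1)}"
  \<comment> \<open>The pairs of a cost vector \<open>w\<close> and a lower bound \<open>t\<close>
    certified by some \<psi> and \<sigma>. Letting \<open>w\<close> range over all vectors makes
    this a convex cone.\<close>
  define K where "K = {(w :: real ^ 'n, t :: real). \<exists>\<psi> \<sigma>. 0 \<le> \<psi> \<and> 0 \<le> \<sigma> \<and>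
    A *v (transpose D *v \<psi> - w) \<le> \<sigma> *\<^sub>R b \<and> t \<le> g \<bullet> \<psi> - \<eta> * \<sigma>}"
  have "finite S"
    by (simp add: S_def X_def finite_binary_feasible)
  have "(x, \<mu>) \<in> convex_cone hull S"
  proof (rule ccontr)
    assume "(x, \<mu>) \<notin> convex_cone hull S"
    then obtain a where a: "a \<bullet> (x, \<mu>) < 0" "\<And>s. s \<in> S \<Longrightarrow> a \<bullet> s \<ge> 0"
      using convex_cone_hull_Farkas[OF \<open>finite S\<close>] by blast
    \<comment> \<open>With this sign, nonnegativity on \<open>S\<close> says that \<theta> satisfies
      the constraints homogenised by \<open>s\<close> \<ge> 0.\<close>
    obtain \<theta> s where a_eq: "a = (\<theta>, - s)"
      by (metis minus_minus surj_pair)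
    have lt: "\<theta> \<bullet> x < s * \<mu>"
      using a(1) by (simp add: a_eq)
    have "0 \<le> s"
      using a(2)[of "(0, - 1)"] by (simp add: a_eq S_def)
    have "\<theta> \<bullet> D $ i \<ge> s * g $ i" for i
      using a(2)[of "(D $ i, g $ i)"] by (simp add: a_eq S_def)
    then have D: "s *\<^sub>R g \<le> D *v \<theta>"
      by (simp add: less_eq_vec_def matrix_vector_mul_component inner_commute)
    have \<eta>: "\<theta> \<bullet> x' \<le> s * \<eta>" if "x' \<in> X" for x'
      using a(2)[of "(- x', - \<eta>)"] that by (simp add: a_eq S_def)
    show False
    \<comment> \<open>If \<open>s\<close> vanishes, \<theta> is a recession direction and hence 0;
      otherwise \<theta> divided by \<open>s\<close> is feasible and violates the bound
      \<mu>.\<close>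
    proof (cases "s = 0")
      case True
      then have "\<theta> = 0"
        using bounded_polyhedron_recession[OF bdd, of \<theta>\<^sub>0 \<theta>] \<theta>\<^sub>0 D
        by (simp add: restricted_uncertainty_set_def)
      with lt True show False by simp
    next
      case False
      with \<open>0 \<le> s\<close> have "s > 0" by simp
      have "(1 / s) *\<^sub>R s *\<^sub>R g \<le> D *v ((1 / s) *\<^sub>R \<theta>)"
        unfolding matrix_vector_mult_scaleR using D \<open>s > 0\<close> by (intro scaleR_left_mono) auto
      then have "(1 / s) *\<^sub>R \<theta> \<in> restricted_uncertainty_set A b D g \<eta>"
        using \<open>s > 0\<close> \<eta> unfolding restricted_uncertainty_set_iff[OF ne]
        by (simp add: X_def field_simps)
      from \<mu>[OF this] lt \<open>s > 0\<close> show False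
        by (simp add: field_simps)
    qed
  qed
  \<comment> \<open>Minimality of the hull replaces the aggregation of explicit multipliers for the
    points of \<X> into a single \<sigma>.\<close>
  moreover have "convex_cone hull S \<subseteq> K"
  proof (rule hull_minimal)
    show "convex_cone K"
      unfolding convex_cone_iff
    proof (intro conjI ballI allI impI)
      show "0 \<in> K"
        unfolding K_def zero_prod_def by (auto intro!: exI[of _ 0])
    next
      fix u v assume "u \<in> K" "v \<in> K"
      then obtain w t \<psi> \<sigma> w' t' \<psi>' \<sigma>' where u: "u = (w, t)" "v = (w', t')"
        and *: "0 \<le> \<psi>" "0 \<le> \<sigma>" "A *v (transpose D *v \<psi> - w) \<le> \<sigma> *\<^sub>R b" "t \<le> g \<bullet> \<psi> - \<eta> * \<sigma>"
          "0 \<le> \<psi>'" "0 \<le> \<sigma>'" "A *v (transpose D *v \<psi>' - w') \<le> \<sigma>' *\<^sub>R b" "t' \<le> g \<bullet> \<psi>' - \<eta> * \<sigma>'"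
        unfolding K_def by blast
      have "A *v (transpose D *v (\<psi> + \<psi>') - (w + w')) \<le> (\<sigma> + \<sigma>') *\<^sub>R b"
        using add_mono[OF *(3) *(7)]
        by (simp add: algebra_simps matrix_vector_right_distrib matrix_vector_mult_diff_distrib)
      moreover have "t + t' \<le> g \<bullet> (\<psi> + \<psi>') - \<eta> * (\<sigma> + \<sigma>')"
        using *(4,8) by (simp add: algebra_simps inner_add_right)
      ultimately show "u + v \<in> K"
        unfolding K_def u using *(1,2,5,6)
        by (auto intro!: exI[of _ "\<psi> + \<psi>'"] exI[of _ "\<sigma> + \<sigma>'"])
    next
      fix u and c :: real assume "u \<in> K" "0 \<le> c"
      then obtain w t \<psi> \<sigma> where u: "u = (w, t)"
        and *: "0 \<le> \<psi>" "0 \<le> \<sigma>" "A *v (transpose D *v \<psi> - w) \<le> \<sigma> *\<^sub>R b" "t \<le> g \<bullet> \<psi> - \<eta> * \<sigma>"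
        unfolding K_def by blast
      have "A *v (transpose D *v (c *\<^sub>R \<psi>) - c *\<^sub>R w) \<le> (c * \<sigma>) *\<^sub>R b"
        using scaleR_left_mono[OF *(3) \<open>0 \<le> c\<close>]
        by (simp add: matrix_vector_mult_scaleR flip: scaleR_diff_right)
      moreover have "c * t \<le> g \<bullet> (c *\<^sub>R \<psi>) - \<eta> * (c * \<sigma>)"
        using mult_left_mono[OF *(4) \<open>0 \<le> c\<close>] by (simp add: algebra_simps)
      ultimately show "c *\<^sub>R u \<in> K"
        unfolding K_def u using *(1,2) \<open>0 \<le> c\<close>
        by (auto intro!: exI[of _ "c *\<^sub>R \<psi>"] exI[of _ "c * \<sigma>"] simp: scaleR_nonneg_nonneg)
    qed
    \<comment> \<open>Witnesses: a unit vector for \<psi> and \<sigma> = 0, leaving no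
      remainder.\<close>
    have "(D $ i, g $ i) \<in> K" for i
    proof -
      have "transpose D *v axis i 1 = D $ i"
        by (simp add: matrix_vector_mult_basis column_def transpose_def)
      moreover have "0 \<le> (axis i 1 :: real ^ 'q)"
        by (simp add: less_eq_vec_def axis_def)
      ultimately show ?thesis
        unfolding K_def mem_Collect_eq prod.case
        by (intro exI[of _ "axis i 1"] exI[of _ 0]) (simp add: inner_axis)
    qed
    \<comment> \<open>With \<psi> = 0 and \<sigma> = 1 the constraint reduces to feasibility of
      \<open>x'\<close>.\<close>
    moreover have "(- x', - \<eta>) \<in> K" if "x' \<in> X" for x'
      using that unfolding K_def X_def binary_feasible_def mem_Collect_eq prod.case
      by (intro exI[of _ "0 :: real ^ 'q"] exI[of _ "1 :: real"]) simp
    moreover have "(0, - 1) \<in> K"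
      unfolding K_def by (auto intro!: exI[of _ 0])
    ultimately show "S \<subseteq> K"
      by (auto simp: S_def)
  qed
  ultimately have "(x, \<mu>) \<in> K" by blast
  with x show thesis
    by (auto simp: K_def milp_feasible_def milp_objective_def binary_feasible_def intro: that)
qed

theorem proposition6:
  fixes A :: "real ^ 'n ^ 'm" and b :: "real ^ 'm"
    and D :: "real ^ 'n ^ 'q" and g :: "real ^ 'q" and \<eta> :: real
  assumes "binary_feasible A b \<noteq> {}"
    and "convex hull (binary_feasible A b) = {x. A *v x \<le> b}"
    and "uncertainty_set D g \<noteq> {}"
    and "bounded (uncertainty_set D g)"
    and "restricted_uncertainty_set A b D g \<eta> \<noteq> {}"
  shows "\<exists>\<mu> v.
      (\<forall>x\<in>binary_feasible A b.
         is_min_value (\<lambda>\<theta>. \<theta> \<bullet> x) (restricted_uncertainty_set A b D g \<eta>) (\<mu> x)) \<and>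
      is_max_value \<mu> (binary_feasible A b) v \<and>
      is_max_value (milp_objective g \<eta>) (milp_feasible A b D) v"
proof -
  let ?X = "binary_feasible A b" and ?U = "restricted_uncertainty_set A b D g \<eta>"
  have "\<exists>\<theta>\<in>?U. \<forall>\<theta>'\<in>?U. \<theta> \<bullet> x \<le> \<theta>' \<bullet> x" for x
    by (intro continuous_attains_inf compact_restricted_uncertainty_set assms continuous_intros)
  then obtain \<Theta> where \<Theta>: "\<And>x. \<Theta> x \<in> ?U" "\<And>x \<theta>. \<theta> \<in> ?U \<Longrightarrow> \<Theta> x \<bullet> x \<le> \<theta> \<bullet> x"
    by metis
  define \<mu> where "\<mu> x = \<Theta> x \<bullet> x" for x
  have min: "is_min_value (\<lambda>\<theta>. \<theta> \<bullet> x) ?U (\<mu> x)" for x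
    using \<Theta> by (auto simp: is_min_value_def \<mu>_def)
  have "Max (\<mu> ` ?X) \<in> \<mu> ` ?X"
    using assms(1) finite_binary_feasible by (intro Max_in) auto
  then obtain x where x: "x \<in> ?X" "\<mu> x = Max (\<mu> ` ?X)"
    by force
  have x_max: "\<mu> x' \<le> \<mu> x" if "x' \<in> ?X" for x'
    using that finite_binary_feasible[of A b] by (simp add: x(2))
  \<comment> \<open>Strong duality is needed only at an outer maximiser \<open>x\<close>; weak
    duality bounds all other feasible points through \<open>x_max\<close>.\<close>
  obtain \<psi> \<sigma> where dual: "(x, \<psi>, \<sigma>) \<in> milp_feasible A b D" "\<mu> x \<le> milp_objective g \<eta> (x, \<psi>, \<sigma>)"
    using milp_dual_attained[OF assms(1,4) \<Theta>(1) x(1), of "\<mu> x"] \<Theta>(2) unfolding \<mu>_def by blast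
  have weak: "milp_objective g \<eta> p \<le> \<mu> x" if "p \<in> milp_feasible A b D" for p
  proof -
    obtain x' \<psi>' \<sigma>' where p: "p = (x', \<psi>', \<sigma>')"
      by (cases p)
    then have "x' \<in> ?X"
      using that by (auto simp: milp_feasible_def binary_feasible_def)
    have "milp_objective g \<eta> p \<le> \<mu> x'"
      using milp_objective_le[OF assms(1,2) \<Theta>(1)] that unfolding p \<mu>_def by blast
    with x_max[OF \<open>x' \<in> ?X\<close>] show ?thesis by linarith
  qed
  have "is_max_value (milp_objective g \<eta>) (milp_feasible A b D) (\<mu> x)"
    unfolding is_max_value_def using weak dual by (meson order_antisym)
  moreover have "is_max_value \<mu> ?X (\<mu> x)"
    unfolding is_max_value_def using x(1) x_max by blast
  ultimately show ?thesis
    using min by blast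
qed

end
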